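(* Every triangle-free graph of minimum degree $d\ge 1$ contains a semi-bipartite induced subgraph of average degree (with respect to its semi-bipartition) at least $\tfrac12\log d$.
   Context: All graphs are finite and simple; $\log$ is the natural logarithm. Given a graph $G$, an induced subgraph $G'$ of $G$ with vertex set $V'$ is semi-bipartite if it admits a partition $V'=V_1\cup V_2$ such that $V_1$ is a stable set of $G$. Its average degree with respect to this semi-bipartition is the average degree of the bipartite graph $G[V_1,V_2]$ with vertex set $V_1\cup V_2$ consisting of the edges of $G$ with one end in $V_1$ and the other in $V_2$ (edges inside $V_2$ are ignored), i.e. $2e(V_1,V_2)/(|V_1|+|V_2|)$. *)

theory Defs
  imports Complex_Main "Graph_Theory.Digraph_Component"
begin

text \<open>
  A finite simple graph is an instance of the locale \<^locale>\<open>graph\<close>: a finite symmetric digraph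
  without loops and parallel arcs. Every undirected edge is a pair of opposite arcs, so the degree
  of a vertex is its \<^const>\<open>out_degree\<close>.
\<close>

definition triangle_free :: "('a, 'b) pre_digraph \<Rightarrow> bool" where
  "triangle_free G \<longleftrightarrow> \<not> (\<exists>u v w. u \<rightarrow>\<^bsub>G\<^esub> v \<and> v \<rightarrow>\<^bsub>G\<^esub> w \<and> w \<rightarrow>\<^bsub>G\<^esub> u)"

text \<open>Unspecified on the graph without vertices.\<close>
definition min_degree :: "('a, 'b) pre_digraph \<Rightarrow> nat" where
  "min_degree G = Min (out_degree G ` verts G)"

definition average_degree :: "('a, 'b) pre_digraph \<Rightarrow> real" where
  "average_degree G = (\<Sum>v\<in>verts G. real (out_degree G v)) / real (card (verts G))"

definition stable_set :: "('a, 'b) pre_digraph \<Rightarrow> 'a set \<Rightarrow> bool" where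
  "stable_set G S \<longleftrightarrow> S \<subseteq> verts G \<and> \<not> (\<exists>u\<in>S. \<exists>v\<in>S. u \<rightarrow>\<^bsub>G\<^esub> v)"

definition semi_bipartition ::
    "('a, 'b) pre_digraph \<Rightarrow> ('a, 'b) pre_digraph \<Rightarrow> 'a set \<Rightarrow> 'a set \<Rightarrow> bool" where
  "semi_bipartition G G' V1 V2 \<longleftrightarrow>
    verts G' = V1 \<union> V2 \<and> V1 \<inter> V2 = {} \<and> stable_set G V1"

definition bipartite_between ::
    "('a, 'b) pre_digraph \<Rightarrow> 'a set \<Rightarrow> 'a set \<Rightarrow> ('a, 'b) pre_digraph" where
  "bipartite_between G V1 V2 =
    \<lparr> verts = V1 \<union> V2,
      arcs = {e \<in> arcs G. tail G e \<in> V1 \<and> head G e \<in> V2 \<or> tail G e \<in> V2 \<and> head G e \<in> V1},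
      tail = tail G,
      head = head G \<rparr>"

lemma average_degree_bipartite_between:
  assumes "graph G" "V1 \<union> V2 \<subseteq> verts G" "V1 \<inter> V2 = {}"
  shows "average_degree (bipartite_between G V1 V2) =
    2 * real (card {(u, v). u \<in> V1 \<and> v \<in> V2 \<and> u \<rightarrow>\<^bsub>G\<^esub> v}) / (real (card V1) + real (card V2))"
proof -
  interpret graph G by fact
  let ?B = "bipartite_between G V1 V2"
  let ?E = "\<lambda>X Y. {(u, v). u \<in> X \<and> v \<in> Y \<and> u \<rightarrow>\<^bsub>G\<^esub> v}"
  let ?A = "\<lambda>X Y. {e \<in> arcs G. tail G e \<in> X \<and> head G e \<in> Y}"
  have fin: "finite V1" "finite V2"
    using assms(2) finite_subset[OF _ finite_verts] by auto
  have arcs: "card (?A X Y) = card (?E X Y)" for X Y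
  proof -
    have "inj_on (arc_to_ends G) (?A X Y)"
      by (rule inj_on_subset[OF inj_on_arc_to_ends]) blast
    moreover have "arc_to_ends G ` ?A X Y = ?E X Y"
      by (auto simp: arcs_ends_def arc_to_ends_def)
    ultimately have "bij_betw (arc_to_ends G) (?A X Y) (?E X Y)"
      by (simp add: bij_betw_def)
    then show ?thesis by (rule bij_betw_same_card)
  qed
  have swap: "card (?E V2 V1) = card (?E V1 V2)"
  proof -
    have "bij_betw prod.swap (?E V2 V1) (?E V1 V2)"
      by (rule bij_betwI[where g = prod.swap])
        (auto dest: arcs_ends_symmetric[OF sym_arcs])
    then show ?thesis by (rule bij_betw_same_card)
  qed
  have "(\<Sum>v\<in>verts ?B. out_degree ?B v) = card (\<Union>v\<in>verts ?B. out_arcs ?B v)"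
    unfolding out_degree_def using fin
    by (subst card_UN_disjoint)
      (auto simp: bipartite_between_def out_arcs_def intro: finite_subset[OF _ finite_arcs])
  also have "(\<Union>v\<in>verts ?B. out_arcs ?B v) = ?A V1 V2 \<union> ?A V2 V1"
    by (auto simp: bipartite_between_def out_arcs_def)
  also have "card \<dots> = card (?A V1 V2) + card (?A V2 V1)"
    using assms(3) by (intro card_Un_disjoint) auto
  also have "\<dots> = 2 * card (?E V1 V2)"
    by (simp only: arcs swap)
  finally have "(\<Sum>v\<in>verts ?B. out_degree ?B v) = 2 * card (?E V1 V2)" .
  then have "(\<Sum>v\<in>verts ?B. real (out_degree ?B v)) = 2 * real (card (?E V1 V2))"
    by (simp flip: of_nat_sum)
  moreover have "card (verts ?B) = card V1 + card V2"
    using fin assms(3) by (simp add: bipartite_between_def card_Un_disjoint)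
  ultimately show ?thesis by (simp add: average_degree_def)
qed

end

theory Submission
  imports Defs
begin

text \<open>
  Choose a stable set \<open>I\<close> uniformly at random and set \<open>X v = deg v \<cdot> [v \<in> I] + |N v \<inter> I|\<close>.
  Condition on the part \<open>J\<close> of \<open>I\<close> outside the closed neighbourhood of \<open>v\<close>. If \<open>x\<close> neighbours of
  \<open>v\<close> have no neighbour in \<open>J\<close>, then, as these neighbours form a stable set, \<open>I\<close> is one of
  \<open>2 ^ x + 1\<close> sets: \<open>J\<close> together with \<open>v\<close>, or \<open>J\<close> together with some of these neighbours.
  Hence the conditional expectation of \<open>X v\<close> is \<open>(deg v + x \<cdot> 2 ^ (x - 1)) / (2 ^ x + 1)\<close>, which is
  at least \<open>ln (deg v) / 2\<close> whatever \<open>x\<close> is. Summing over all vertices, and since \<open>\<Sum>v. X v\<close>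
  is twice the sum of the degrees in \<open>I\<close>, some stable set \<open>I\<close> has degree sum at least
  \<open>|V| \<cdot> ln d / 4\<close>. This degree sum is the number of edges between \<open>I\<close> and \<open>V - I\<close>.
\<close>

text \<open>Complementation pairs \<open>B\<close> with \<open>A - B\<close>, and the two
  cardinalities add up to \<open>card A\<close>.\<close>

lemma sum_card_Pow:
  assumes "finite A"
  shows "2 * (\<Sum>B\<in>Pow A. card B) = card A * 2 ^ card A"
proof -
  have "(\<Sum>B\<in>Pow A. card B) = (\<Sum>B\<in>Pow A. card (A - B))"
    by (rule sum.reindex_bij_witness[where i = "\<lambda>B. A - B" and j = "\<lambda>B. A - B"])
      (auto simp: double_diff)
  then have "2 * (\<Sum>B\<in>Pow A. card B) = (\<Sum>B\<in>Pow A. card B + card (A - B))"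
    by (simp add: sum.distrib)
  also have "\<dots> = (\<Sum>B\<in>Pow A. card A)"
    using assms
    by (intro sum.cong) (auto simp: card_Diff_subset card_mono finite_subset)
  also have "\<dots> = card A * 2 ^ card A"
    using assms by (simp add: card_Pow)
  finally show ?thesis .
qed

text \<open>The bound on the conditional expectation for degree \<open>D\<close>, with denominators
  cleared. It rests on the tangent line of \<open>ln\<close> at \<open>t = 2 ^ x\<close>, which
  gives \<open>ln D \<le> ln t + D / t - 1\<close>.\<close>

lemma ln_mult_power2_le:
  fixes D :: real and x :: nat
  assumes "D > 0"
  shows "(2 ^ x + 1) * ln D \<le> 2 * D + x * 2 ^ x"
proof -
  define t :: real where "t = 2 ^ x"
  have t: "t \<ge> 1" "real x \<le> t"
    using of_nat_less_two_power[of x, where ?'a = real] by (simp_all add: t_def)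
  have "ln (D / t) \<le> D / t - 1"
    using assms t by (intro ln_le_minus_one) simp
  \<comment> \<open>Here \<open>ln t = x * ln 2\<close> and \<open>ln 2 \<le> 1\<close>.\<close>
  moreover have "ln t \<le> x"
    using ln_le_minus_one[of 2] by (simp add: t_def ln_realpow mult_left_le)
  ultimately have "ln D \<le> D / t + x - 1"
    using assms t by (simp add: ln_div)
  then have "(t + 1) * ln D \<le> (t + 1) * (D / t + x - 1)"
    using t by (intro mult_left_mono) auto
  also have "\<dots> = D + D / t + x * t + x - t - 1"
    using t by (simp add: field_simps)
  also have "\<dots> \<le> 2 * D + x * t"
  proof -
    have "D / t \<le> D"
      using assms t by (simp add: field_simps)
    then show ?thesis
      using t by simp
  qed
  finally show ?thesis
    by (simp add: t_def)
qed

text \<open>Triangle-freeness, applied to three equal vertices, includes the absence of loops.\<close>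
locale triangle_free_neighbourhoods =
  fixes V :: "'a set" and N :: "'a \<Rightarrow> 'a set"
  assumes finite_V: "finite V"
    and N_subset: "N v \<subseteq> V"
    and N_sym: "u \<in> N v \<Longrightarrow> v \<in> N u"
    and N_stable: "u \<in> N v \<Longrightarrow> w \<in> N v \<Longrightarrow> w \<notin> N u"
begin

lemma finite_N: "finite (N v)"
  using finite_V N_subset by (rule finite_subset[rotated])

lemma N_irrefl: "v \<notin> N v"
  using N_stable by blast

definition stable_sets :: "'a set set" where
  "stable_sets = {I. I \<subseteq> V \<and> (\<forall>u\<in>I. N u \<inter> I = {})}"

lemma finite_stable_sets: "finite stable_sets"
  using finite_V by (auto simp: stable_sets_def intro: finite_subset[of _ "Pow V"])

text \<open>As the trace of the stable set \<open>J0\<close>, \<open>J\<close> is stable. As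
  \<open>N v\<close> is stable, its vertices can conflict only with \<open>v\<close> or with
  \<open>J\<close>, so those without neighbours in \<open>J\<close> may be added to \<open>J\<close>
  freely.\<close>

lemma stable_sets_with_trace:
  assumes "v \<in> V" and "J0 \<in> stable_sets" and J: "J = J0 - insert v (N v)"
  shows "{I \<in> stable_sets. I - insert v (N v) = J} =
    insert (insert v J) ((\<union>) J ` Pow {u \<in> N v. N u \<inter> J = {}})"
    (is "?F = ?R")
proof
  show "?F \<subseteq> ?R"
  proof
    fix I
    assume I: "I \<in> ?F"
    show "I \<in> ?R"
    proof (cases "v \<in> I")
      case True
      then have "N v \<inter> I = {}"
        using I by (auto simp: stable_sets_def)
      then have "I = insert v J"
        using I True by blast
      then show ?thesis by simp
    next
      case False
      then have "I = J \<union> (I \<inter> N v)"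
        using I by blast
      moreover have "I \<inter> N v \<in> Pow {u \<in> N v. N u \<inter> J = {}}"
        using I by (fastforce simp: stable_sets_def)
      ultimately show ?thesis by blast
    qed
  qed
  have J_stable: "J \<subseteq> V" "\<And>u w. u \<in> J \<Longrightarrow> w \<in> J \<Longrightarrow> w \<notin> N u" "v \<notin> J" "J \<inter> N v = {}"
    using assms by (auto simp: stable_sets_def)
  have "insert v J \<in> ?F"
    using J_stable assms(1) N_irrefl N_sym by (auto simp: stable_sets_def)
  moreover have "J \<union> B \<in> ?F" if "B \<subseteq> {u \<in> N v. N u \<inter> J = {}}" for B
  proof -
    have "B \<subseteq> N v" and BJ: "\<And>u w. u \<in> B \<Longrightarrow> w \<in> J \<Longrightarrow> w \<notin> N u"
      using that by auto
    moreover have "\<And>u w. u \<in> J \<Longrightarrow> w \<in> B \<Longrightarrow> w \<notin> N u"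
      using BJ N_sym by metis
    moreover have "\<And>u w. u \<in> B \<Longrightarrow> w \<in> B \<Longrightarrow> w \<notin> N u"
      using \<open>B \<subseteq> N v\<close> N_stable by (meson subsetD)
    ultimately have "\<And>u w. u \<in> J \<union> B \<Longrightarrow> w \<in> J \<union> B \<Longrightarrow> w \<notin> N u"
      using J_stable(2) by (elim UnE) simp_all
    moreover have "J \<union> B \<subseteq> V" "J \<union> B - insert v (N v) = J"
      using \<open>B \<subseteq> N v\<close> J_stable N_subset by blast+
    ultimately show ?thesis
      unfolding stable_sets_def by blast
  qed
  ultimately show "?R \<subseteq> ?F" by blast
qed

text \<open>The quantity \<open>X v\<close> of the averaging argument, as a function of the stable set.\<close>
definition local_weight :: "'a \<Rightarrow> 'a set \<Rightarrow> nat" where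
  "local_weight v I = (if v \<in> I then card (N v) else 0) + card (N v \<inter> I)"

text \<open>The conditional bound, multiplied by the number of sets with trace \<open>J\<close> so
  that no division occurs.\<close>

lemma sum_local_weight_with_trace:
  assumes "v \<in> V" and "N v \<noteq> {}" and "J0 \<in> stable_sets" and J: "J = J0 - insert v (N v)"
  shows "(\<Sum>I | I \<in> stable_sets \<and> I - insert v (N v) = J.
    2 * real (local_weight v I) - ln (card (N v))) \<ge> 0"
proof -
  define A where "A = {u \<in> N v. N u \<inter> J = {}}"
  let ?g = "\<lambda>I. 2 * real (local_weight v I) - ln (card (N v))"
  have A: "finite A" "A \<subseteq> N v"
    using finite_N by (auto simp: A_def)
  have J_disj: "v \<notin> J" "J \<inter> N v = {}"
    using J by auto
  have inj: "inj_on ((\<union>) J) (Pow A)"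
    using A J_disj by (intro inj_onI) blast
  have new: "insert v J \<notin> (\<union>) J ` Pow A"
    using A J_disj N_irrefl by blast
  have w_v: "local_weight v (insert v J) = card (N v)"
  proof -
    have "N v \<inter> insert v J = {}"
      using J_disj N_irrefl by blast
    then show ?thesis by (simp add: local_weight_def)
  qed
  have w_A: "local_weight v (J \<union> B) = card B" if "B \<in> Pow A" for B
  proof -
    have "N v \<inter> (J \<union> B) = B" "v \<notin> J \<union> B"
      using that A J_disj N_irrefl by blast+
    then show ?thesis by (simp add: local_weight_def)
  qed
  have "(\<Sum>I | I \<in> stable_sets \<and> I - insert v (N v) = J. ?g I) =
      ?g (insert v J) + (\<Sum>B\<in>Pow A. ?g (J \<union> B))"
    unfolding stable_sets_with_trace[OF assms(1,3) J] A_def[symmetric]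
    using A new by (simp add: sum.reindex[OF inj])
  also have "\<dots> = 2 * real (card (N v)) + real (2 * (\<Sum>B\<in>Pow A. card B))
      - (2 ^ card A + 1) * ln (card (N v))"
    using A w_v w_A by (simp add: sum_subtractf card_Pow sum_distrib_left algebra_simps)
  also have "\<dots> = 2 * real (card (N v)) + card A * 2 ^ card A
      - (2 ^ card A + 1) * ln (card (N v))"
    by (simp add: sum_card_Pow[OF A(1)] del: of_nat_sum)
  also have "\<dots> \<ge> 0"
    using ln_mult_power2_le[of "card (N v)" "card A"] assms(2) finite_N
    by (simp add: card_gt_0_iff)
  finally show ?thesis .
qed

text \<open>Total expectation: the stable sets are partitioned by their traces outside the closed
  neighbourhood of \<open>v\<close>, and each class contributes a nonnegative sum.\<close>

lemma sum_local_weight_stable_sets: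
  assumes "v \<in> V" and "N v \<noteq> {}"
  shows "card stable_sets * ln (card (N v)) \<le> 2 * (\<Sum>I\<in>stable_sets. real (local_weight v I))"
proof -
  have "0 \<le> (\<Sum>I\<in>stable_sets. 2 * real (local_weight v I) - ln (card (N v)))"
    using sum_local_weight_with_trace[OF assms]
    by (subst sum.image_gen[OF finite_stable_sets, of _ "\<lambda>I. I - insert v (N v)"])
      (rule sum_nonneg, blast)
  then show ?thesis
    by (simp add: sum_subtractf sum_distrib_left)
qed

text \<open>Each \<open>u \<in> I\<close> contributes its degree once as the vertex
  \<open>v = u\<close> and, by symmetry of adjacency, once more through its neighbours
  \<open>v\<close>.\<close>

lemma sum_local_weight:
  assumes "I \<subseteq> V"
  shows "(\<Sum>v\<in>V. local_weight v I) = 2 * (\<Sum>u\<in>I. card (N u))"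
proof -
  have fin: "finite I"
    using assms finite_V by (rule finite_subset)
  have "(\<Sum>v\<in>V. card (N v \<inter> I)) = (\<Sum>v\<in>V. \<Sum>u\<in>I. if u \<in> N v then 1 else 0)"
    using fin by (simp add: sum.If_cases Int_commute)
  also have "\<dots> = (\<Sum>u\<in>I. \<Sum>v\<in>V. if v \<in> N u then 1 else 0)"
    by (subst sum.swap) (auto intro!: sum.cong dest: N_sym)
  also have "\<dots> = (\<Sum>u\<in>I. card (N u))"
    using finite_V N_subset by (simp add: sum.If_cases Int_absorb1)
  finally have "(\<Sum>v\<in>V. card (N v \<inter> I)) = (\<Sum>u\<in>I. card (N u))" .
  moreover have "(\<Sum>v\<in>V. if v \<in> I then card (N v) else 0) = (\<Sum>u\<in>I. card (N u))"
    using finite_V assms by (simp add: sum.If_cases Int_absorb1)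
  ultimately show ?thesis
    by (simp add: local_weight_def sum.distrib)
qed

text \<open>The factor 4 combines the 2 of the local bound with the 2 of the double
  counting.\<close>

lemma ex_stable_set_large_degree_sum:
  fixes d :: nat
  assumes "d \<ge> 1" and deg: "\<And>v. v \<in> V \<Longrightarrow> d \<le> card (N v)"
  obtains I where "I \<in> stable_sets" and "card V * ln d \<le> 4 * real (\<Sum>u\<in>I. card (N u))"
proof -
  have "card stable_sets * ln d \<le> 2 * (\<Sum>I\<in>stable_sets. real (local_weight v I))"
    if "v \<in> V" for v
  proof -
    have "N v \<noteq> {}" "ln d \<le> ln (card (N v))"
      using deg[OF that] assms(1) by auto
    then show ?thesis
      using sum_local_weight_stable_sets[OF that]
      by (meson mult_left_mono of_nat_0_le_iff order_trans)
  qed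
  then have "(\<Sum>v\<in>V. card stable_sets * ln d) \<le>
      (\<Sum>v\<in>V. 2 * (\<Sum>I\<in>stable_sets. real (local_weight v I)))"
    by (rule sum_mono)
  also have "\<dots> = 2 * (\<Sum>I\<in>stable_sets. real (\<Sum>v\<in>V. local_weight v I))"
    unfolding sum_distrib_left[symmetric] by (subst sum.swap) simp
  also have "\<dots> = 2 * (\<Sum>I\<in>stable_sets. real (2 * (\<Sum>u\<in>I. card (N u))))"
    by (intro arg_cong[where f = "(*) 2"] sum.cong refl)
      (simp add: sum_local_weight stable_sets_def del: of_nat_sum)
  also have "\<dots> = (\<Sum>I\<in>stable_sets. 4 * real (\<Sum>u\<in>I. card (N u)))"
    by (simp add: sum_distrib_left)
  finally have le: "(\<Sum>I\<in>stable_sets. card V * ln d) \<le>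
      (\<Sum>I\<in>stable_sets. 4 * real (\<Sum>u\<in>I. card (N u)))"
    by (simp add: mult.left_commute)
  \<comment> \<open>The empty set is stable. Hence, if every stable set violated the bound, summing
    would give a strict inequality against \<open>le\<close>.\<close>
  have "stable_sets \<noteq> {}"
    by (auto simp: stable_sets_def)
  then have "\<exists>I\<in>stable_sets. card V * ln d \<le> 4 * real (\<Sum>u\<in>I. card (N u))"
    using le sum_strict_mono[OF finite_stable_sets] by (meson not_le)
  then show ?thesis
    using that by blast
qed

end

lemma (in graph) out_degree_eq_card_adj: "out_degree G v = card {w. v \<rightarrow>\<^bsub>G\<^esub> w}"
proof -
  have "inj_on (head G) (out_arcs G v)"
    by (intro inj_onI) (auto intro!: no_multi_arcs simp: arc_to_ends_def)
  moreover have "head G ` out_arcs G v = {w. v \<rightarrow>\<^bsub>G\<^esub> w}"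
    by (auto simp: arcs_ends_def arc_to_ends_def)
  ultimately show ?thesis
    by (metis card_image out_degree_def)
qed

theorem theorem3p5:
  fixes G :: "('a, 'b) pre_digraph" and d :: nat
  assumes "graph G" and "verts G \<noteq> {}"
    and "triangle_free G"
    and "min_degree G = d" and "d \<ge> 1"
  shows "\<exists>G' V1 V2. induced_subgraph G' G \<and> verts G' \<noteq> {} \<and> semi_bipartition G G' V1 V2 \<and>
    average_degree (bipartite_between G V1 V2) \<ge> 1 / 2 * ln (real d)"
proof -
  interpret graph G by fact
  define N where "N v = {w. v \<rightarrow>\<^bsub>G\<^esub> w}" for v
  have sym: "v \<rightarrow>\<^bsub>G\<^esub> u" if "u \<rightarrow>\<^bsub>G\<^esub> v" for u v
    using that by (rule arcs_ends_symmetric[OF sym_arcs])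
  interpret triangle_free_neighbourhoods "verts G" N
  proof
    show "w \<notin> N u" if "u \<in> N v" "w \<in> N v" for u v w
      using that assms(3) sym unfolding triangle_free_def N_def by blast
  qed (auto simp: N_def intro: sym)
  have "d \<le> card (N v)" if "v \<in> verts G" for v
    using that assms(4) by (auto simp: min_degree_def N_def simp flip: out_degree_eq_card_adj)
  then obtain I where I: "I \<in> stable_sets"
    and le: "card (verts G) * ln d \<le> 4 * real (\<Sum>u\<in>I. card (N u))"
    using ex_stable_set_large_degree_sum[OF assms(5)] by blast
  have I_sub: "I \<subseteq> verts G" and I_stable: "\<And>u. u \<in> I \<Longrightarrow> N u \<inter> I = {}"
    using I by (auto simp: stable_sets_def)
  have fin: "finite I"
    using I_sub finite_verts by (rule finite_subset)
  \<comment> \<open>Every edge at a vertex of \<open>I\<close> leaves \<open>I\<close>, so none is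
    lost in the bipartite graph.\<close>
  have "{(u, v). u \<in> I \<and> v \<in> verts G - I \<and> u \<rightarrow>\<^bsub>G\<^esub> v} = Sigma I N"
    using I_stable N_subset unfolding N_def by blast
  then have edges: "card {(u, v). u \<in> I \<and> v \<in> verts G - I \<and> u \<rightarrow>\<^bsub>G\<^esub> v} = (\<Sum>u\<in>I. card (N u))"
    using fin finite_N by simp
  have "card I + card (verts G - I) = card (verts G)"
    using I_sub fin by (simp add: card_Diff_subset card_mono)
  then have "average_degree (bipartite_between G I (verts G - I)) =
      2 * real (\<Sum>u\<in>I. card (N u)) / card (verts G)"
    using I_sub average_degree_bipartite_between[OF assms(1), of I "verts G - I", unfolded edges]
    by (simp add: Un_absorb1 flip: of_nat_add)
  moreover have "1 / 2 * ln d \<le> 2 * real (\<Sum>u\<in>I. card (N u)) / card (verts G)"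
    using le assms(2) by (simp add: field_simps card_gt_0_iff del: of_nat_sum)
  \<comment> \<open>The induced subgraph is \<open>G\<close> itself, split into \<open>I\<close> and
    its complement.\<close>
  moreover have "semi_bipartition G G I (verts G - I)"
    using I_sub I_stable by (auto simp: semi_bipartition_def stable_set_def N_def)
  moreover have "induced_subgraph G G"
    by (rule induced_subgraph_refl)
  ultimately show ?thesis
    using assms(2) by metis
qed

end
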